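(* For every positive integer $n$, $$\sum_{k=0}^{n-1}(3k+2)(-1)^k f_k \equiv \begin{cases} 2n^2, & \text{if $n$ is a power of $2$},\\ 0, & \text{otherwise},\end{cases} \pmod{4n^2},$$ where $f_k=\sum_{j=0}^{k}\binom{k}{j}^3$ is the $k$-th Franel number.
   Context: The Franel numbers are defined for all nonnegative integers $k$ by $f_k=\sum_{j=0}^{k}\binom{k}{j}^3$. Here "power of $2$" includes $2^0=1$. *)

theory Defs
  imports "HOL-Number_Theory.Number_Theory"
begin

definition franel :: "nat \<Rightarrow> nat" where
  "franel k = (\<Sum>j=0..k. (k choose j) ^ 3)"

end

theory Submission
  imports Defs
begin

text \<open>
  Since \<open>(n+1)\<^sup>2 f\<^bsub>n+1\<^esub> = (7n\<^sup>2 + 7n + 2) f\<^bsub>n\<^esub> + 8n\<^sup>2 f\<^bsub>n-1\<^esub>\<close>, the sequence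
  \<open>(-1)\<^sup>n n\<^sup>2 (f\<^bsub>n\<^esub> - 8 f\<^bsub>n-1\<^esub>)\<close> has differences \<open>3 (3n + 2) (-1)\<^sup>n f\<^bsub>n\<^esub>\<close>. The sum in question is
  therefore \<open>(-1)\<^sup>n n\<^sup>2 (f\<^bsub>n\<^esub> - 8 f\<^bsub>n-1\<^esub>) / 3\<close>, and what remains is \<open>f\<^bsub>n\<^esub>\<close> modulo 4. Pairing the
  indices \<open>j\<close> and \<open>n - j\<close> shows that \<open>f\<^bsub>n\<^esub>\<close> is congruent to the central binomial coefficient
  \<open>(2n choose n)\<close>, which modulo 4 is 2 if \<open>n\<close> is a power of 2 and 0 otherwise.
\<close>

section \<open>Recurrence for the Franel numbers by creative telescoping\<close>

text \<open>The certificate produced by Zeilberger's algorithm for the summand \<open>(n choose k)\<^sup>3\<close>.\<close>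

definition franel_certificate :: "nat \<Rightarrow> nat \<Rightarrow> real" where
  "franel_certificate n k =
     (4 * real k ^ 3 - (30 + 18 * real n) * real k ^ 2 + (78 + 93 * real n + 27 * real n ^ 2) * real k
        - (72 + 128 * real n + 74 * real n ^ 2 + 14 * real n ^ 3))
       * (real k * real (n + 2 choose k)) ^ 3 / ((real n + 1) * (real n + 2) ^ 3)"

lemma franel_certificate_diff:
  "(real n + 2) ^ 2 * real (n + 2 choose k) ^ 3
     - (7 * real n ^ 2 + 21 * real n + 16) * real (n + 1 choose k) ^ 3
     - 8 * (real n + 1) ^ 2 * real (n choose k) ^ 3
   = franel_certificate n (Suc k) - franel_certificate n k"
proof -
  define N K where "N = real n" and "K = real k"
  define P where "P = (\<lambda>k. 4 * k ^ 3 - (30 + 18 * N) * k ^ 2 + (78 + 93 * N + 27 * N ^ 2) * k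
                        - (72 + 128 * N + 74 * N ^ 2 + 14 * N ^ 3))"
  \<comment> \<open>With this scaling every binomial below is a polynomial in \<open>N\<close> and
    \<open>K\<close> times \<open>w\<close>. No division by \<open>N + 1 - K\<close> or
    \<open>N + 2 - K\<close>, which may vanish, is needed, and the claim reduces to the polynomial
    identity \<open>poly\<close>.\<close>
  define w where "w = real (n + 2 choose k) / ((N + 1) * (N + 2))"
  have pos: "N + 1 \<noteq> 0" "N + 2 \<noteq> 0"
    by (auto simp: N_def add_eq_0_iff)
  have absorb: "real (Suc m) * real (m choose k) = (real (Suc m) - K) * real (Suc m choose k)" for m
  proof (cases "k \<le> Suc m")
    case True
    have "(Suc m - k) * (Suc m choose k) = Suc m * (m choose k)"
      using binomial_absorb_comp[of "Suc m" k] by simp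
    then show ?thesis
      using True by (metis K_def of_nat_diff of_nat_mult)
  qed (simp add: binomial_eq_0)
  have x2: "real (n + 2 choose k) = (N + 1) * (N + 2) * w"
    using pos by (simp add: w_def)
  have "(N + 2) * real (n + 1 choose k) = (N + 2 - K) * real (n + 2 choose k)"
    using absorb[of "n + 1"] by (simp add: N_def add_ac)
  then have "(N + 2) * real (n + 1 choose k) = (N + 2) * ((N + 1) * (N + 2 - K) * w)"
    unfolding x2 by (simp only: mult_ac)
  then have x1: "real (n + 1 choose k) = (N + 1) * (N + 2 - K) * w"
    using pos by simp
  have "(N + 1) * real (n choose k) = (N + 1 - K) * real (n + 1 choose k)"
    using absorb[of "n"] by (simp add: N_def add_ac)
  then have "(N + 1) * real (n choose k) = (N + 1) * ((N + 1 - K) * (N + 2 - K) * w)"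
    unfolding x1 by (simp only: mult_ac)
  then have x0: "real (n choose k) = (N + 1 - K) * (N + 2 - K) * w"
    using pos by simp
  have "Suc k * (n + 2 choose Suc k) = (n + 2) * (n + 1 choose k)"
    using Suc_times_binomial[of k "n + 1"] by simp
  then have "real (Suc k) * real (n + 2 choose Suc k) = (N + 2) * real (n + 1 choose k)"
    by (metis N_def of_nat_add of_nat_mult of_nat_numeral)
  then have y: "real (Suc k) * real (n + 2 choose Suc k) = (N + 2) * (N + 1) * (N + 2 - K) * w"
    unfolding x1 by (simp only: mult_ac)
  have scale: "p * ((N + 2) * (N + 1) * z) ^ 3 / ((N + 1) * (N + 2) ^ 3) = (N + 1) ^ 2 * (p * z ^ 3)" for p z
    using pos by (simp add: power_mult_distrib power2_eq_square power3_eq_cube)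
  have G1: "franel_certificate n (Suc k) = (N + 1) ^ 2 * (P (K + 1) * ((N + 2 - K) * w) ^ 3)"
    using scale[of "P (K + 1)" "(N + 2 - K) * w"] unfolding franel_certificate_def y
    by (simp add: P_def N_def[symmetric] K_def[symmetric] mult.assoc add.commute)
  have G0: "franel_certificate n k = (N + 1) ^ 2 * (P K * (K * w) ^ 3)"
    using scale[of "P K" "K * w"] unfolding franel_certificate_def x2
    by (simp add: P_def N_def[symmetric] K_def[symmetric] mult_ac)
  have poly: "(N + 2) ^ 2 * ((N + 1) * (N + 2) ^ 3) - (7 * N ^ 2 + 21 * N + 16) * ((N + 1) * (N + 2 - K) ^ 3)
      - 8 * ((N + 1 - K) * (N + 2 - K)) ^ 3 = P (K + 1) * (N + 2 - K) ^ 3 - P K * K ^ 3"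
    unfolding P_def by (simp add: algebra_simps power_numeral_reduce)
  have factor: "(N + 2) ^ 2 * ((N + 1) * (N + 2) * w) ^ 3 - r * ((N + 1) * x * w) ^ 3 - 8 * (N + 1) ^ 2 * (y * w) ^ 3
      = (N + 1) ^ 2 * w ^ 3 * ((N + 2) ^ 2 * ((N + 1) * (N + 2) ^ 3) - r * ((N + 1) * x ^ 3) - 8 * y ^ 3)" for r x y
    by (simp add: right_diff_distrib power_mult_distrib power2_eq_square power3_eq_cube)
  show ?thesis
    unfolding G1 G0 x0 x1 x2 N_def[symmetric] factor poly
    by (simp only: power_mult_distrib) (simp only: right_diff_distrib mult_ac)
qed

text \<open>Summing the certificate identity over \<open>k < n + 3\<close> telescopes. Both boundary
  terms vanish: the certificate has a factor \<open>k\<close>, and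
  \<open>n + 2 choose (n + 3)\<close> is 0.\<close>

lemma franel_recurrence:
  "(int n + 2) ^ 2 * int (franel (n + 2))
     = (7 * int n ^ 2 + 21 * int n + 16) * int (franel (n + 1)) + 8 * (int n + 1) ^ 2 * int (franel n)"
proof -
  have ext: "real (franel m) = (\<Sum>k<n + 3. real (m choose k) ^ 3)" if "m \<le> n + 2" for m
    unfolding franel_def of_nat_sum of_nat_power
    using that by (intro sum.mono_neutral_left) auto
  have e1: "real (franel (n + 1)) = (\<Sum>k<n + 3. real (n + 1 choose k) ^ 3)"
    and e0: "real (franel n) = (\<Sum>k<n + 3. real (n choose k) ^ 3)"
    by (intro ext; simp)+
  have "(real n + 2) ^ 2 * real (franel (n + 2))
           - (7 * real n ^ 2 + 21 * real n + 16) * real (franel (n + 1))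
           - 8 * (real n + 1) ^ 2 * real (franel n) = 0"
    unfolding ext[OF order.refl] e1 e0 sum_distrib_left sum_subtractf[symmetric]
      franel_certificate_diff sum_lessThan_telescope
    by (simp add: franel_certificate_def binomial_eq_0)
  then have "real_of_int ((int n + 2) ^ 2 * int (franel (n + 2))) = real_of_int
     ((7 * int n ^ 2 + 21 * int n + 16) * int (franel (n + 1)) + 8 * (int n + 1) ^ 2 * int (franel n))"
    by simp
  then show ?thesis
    by (simp only: of_int_eq_iff)
qed

section \<open>Closed form of the weighted alternating sum\<close>

lemma franel_weighted_alternating_sum:
  "3 * (\<Sum>k=0..m. (3 * int k + 2) * (-1) ^ k * int (franel k))
     = (-1) ^ Suc m * (int m + 1) ^ 2 * (int (franel (m + 1)) - 8 * int (franel m))"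
proof (induction m)
  case 0
  show ?case by (simp add: franel_def)
next
  case (Suc m)
  define s M a b c where "s = (-1 :: int) ^ m" and "M = int m" and "a = int (franel m)"
    and "b = int (franel (m + 1))" and "c = int (franel (m + 2))"
  have "(\<Sum>k=0..Suc m. (3 * int k + 2) * (-1) ^ k * int (franel k))
      = (\<Sum>k=0..m. (3 * int k + 2) * (-1) ^ k * int (franel k)) - (3 * M + 5) * s * b"
    by (simp add: s_def M_def b_def algebra_simps)
  then have "3 * (\<Sum>k=0..Suc m. (3 * int k + 2) * (-1) ^ k * int (franel k))
      = - s * (M + 1) ^ 2 * (b - 8 * a) - 3 * (3 * M + 5) * s * b"
    using Suc.IH by (simp add: s_def M_def a_def b_def)
  \<comment> \<open>Adding and subtracting \<open>8 * s * (M + 2) ^ 2 * b\<close> makes the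
    right-hand side of the recurrence appear as a block.\<close>
  also have "\<dots> = s * ((7 * M ^ 2 + 21 * M + 16) * b + 8 * (M + 1) ^ 2 * a) - 8 * s * (M + 2) ^ 2 * b"
    by (simp add: algebra_simps power2_eq_square)
  also have "(7 * M ^ 2 + 21 * M + 16) * b + 8 * (M + 1) ^ 2 * a = (M + 2) ^ 2 * c"
    unfolding M_def a_def b_def c_def by (rule franel_recurrence[symmetric])
  also have "s * ((M + 2) ^ 2 * c) - 8 * s * (M + 2) ^ 2 * b = s * (M + 2) ^ 2 * (c - 8 * b)"
    by (simp add: algebra_simps)
  finally show ?case
    by (simp add: s_def M_def b_def c_def add.commute)
qed

section \<open>Residues modulo 3\<close>

text \<open>By Fermat, cubing is the identity modulo 3, so the row sum \<open>2 ^ n\<close> replaces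
  the sum of cubes. This serves to cancel the 3 in the closed form, which need not be invertible
  modulo \<open>4 * n ^ 2\<close>.\<close>

lemma franel_mod_3: "[int (franel n) = (-1) ^ n] (mod 3)"
proof -
  have cube: "[x ^ 3 = x] (mod 3)" for x :: int
  proof -
    have "x mod 3 = 0 \<or> x mod 3 = 1 \<or> x mod 3 = 2" by presburger
    then show ?thesis
      unfolding cong_def by (subst power_mod[symmetric]) auto
  qed
  have "int (franel n) = (\<Sum>k\<le>n. int (n choose k) ^ 3)"
    by (simp add: franel_def atMost_atLeast0)
  also have "[(\<Sum>k\<le>n. int (n choose k) ^ 3) = (\<Sum>k\<le>n. int (n choose k))] (mod 3)"
    by (intro cong_sum cube)
  also have "(\<Sum>k\<le>n. int (n choose k)) = 2 ^ n"
    unfolding of_nat_sum[symmetric] choose_row_sum by simp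
  also have "[2 ^ n = (-1) ^ n :: int] (mod 3)"
    by (intro cong_pow) (simp add: cong_def)
  finally show ?thesis .
qed

section \<open>Residues modulo 4\<close>

text \<open>The terms at \<open>k\<close> and \<open>n - k\<close> add up to twice an even number,
  so only an unpaired middle term survives.\<close>

lemma sum_symmetric_even_mod_4:
  fixes h :: "nat \<Rightarrow> int"
  assumes sym: "\<And>k. k \<le> n \<Longrightarrow> h (n - k) = h k" and ev: "\<And>k. even (h k)"
  shows "[(\<Sum>k\<le>n. h k) = (if even n then h (n div 2) else 0)] (mod 4)"
proof -
  define L R M where "L = {k. 2 * k < n}" and "R = {k. k \<le> n \<and> n < 2 * k}"
    and "M = (if even n then {n div 2} else {})"
  have fin: "finite L" "finite R" "finite M"
    by (auto simp: L_def R_def M_def intro: finite_subset[of _ "{..n}"])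
  have "{..n} = L \<union> (R \<union> M)"
    by (auto simp: L_def R_def M_def elim!: evenE) (metis dvd_triv_left linorder_cases)
  moreover have "L \<inter> (R \<union> M) = {}" "R \<inter> M = {}"
    by (auto simp: L_def R_def M_def)
  ultimately have "(\<Sum>k\<le>n. h k) = sum h L + (sum h R + sum h M)"
    using fin by (simp add: sum.union_disjoint)
  moreover have "sum h R = sum h L"
    by (rule sum.reindex_bij_witness[of _ "\<lambda>k. n - k" "\<lambda>k. n - k"])
      (auto simp: L_def R_def sym)
  moreover have "sum h M = (if even n then h (n div 2) else 0)"
    by (simp add: M_def)
  moreover obtain q where "sum h L = 2 * q"
    using ev by (meson dvd_sum evenE)
  ultimately show ?thesis
    by (simp add: cong_iff_dvd_diff)
qed

lemma central_binomial_sum: "int (2 * n choose n) = (\<Sum>k\<le>n. int (n choose k) ^ 2)"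
  by (simp add: choose_square_sum[symmetric])

text \<open>Pairing is applied to the even numbers \<open>x ^ 2 - x\<close>, with \<open>x\<close>
  running over row \<open>n\<close>: the squares sum to the central binomial and the row to
  \<open>2 ^ n\<close>. For \<open>n = 2 * m\<close> the middle entry is the central binomial of
  \<open>m\<close>, which gives a descent by halving.\<close>

lemma central_binomial_mod_4:
  "n > 0 \<Longrightarrow> [int (2 * n choose n) = (if \<exists>a::nat. n = 2 ^ a then 2 else 0)] (mod 4)"
proof (induction n rule: less_induct)
  case (less n)
  have "[(\<Sum>k\<le>n. int (n choose k) ^ 2 - int (n choose k))
      = (if even n then int (n choose (n div 2)) ^ 2 - int (n choose (n div 2)) else 0)] (mod 4)"
    by (rule sum_symmetric_even_mod_4) (auto simp: binomial_symmetric[symmetric])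
  moreover have "(\<Sum>k\<le>n. int (n choose k)) = 2 ^ n"
    unfolding of_nat_sum[symmetric] choose_row_sum by simp
  ultimately have main: "[int (2 * n choose n) - 2 ^ n
      = (if even n then int (n choose (n div 2)) ^ 2 - int (n choose (n div 2)) else 0)] (mod 4)"
    by (simp add: sum_subtractf central_binomial_sum)
  have pow: "4 dvd (2 :: int) ^ n" if "n \<ge> 2"
    using le_imp_power_dvd[OF that, of "2 :: int"] by simp
  show ?case
  proof (cases "even n")
    case True
    then obtain m where m: "n = 2 * m" by blast
    define c where "c = int (2 * m choose m)"
    have "m > 0" "m < n" using less.prems m by auto
    then have IH: "[c = (if \<exists>a::nat. m = 2 ^ a then 2 else 0)] (mod 4)"
      using less.IH unfolding c_def by blast
    have iff: "(\<exists>a::nat. n = 2 ^ a) \<longleftrightarrow> (\<exists>a::nat. m = 2 ^ a)"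
    proof
      assume "\<exists>a::nat. n = 2 ^ a"
      then obtain a where a: "n = 2 ^ a" by blast
      with m have "a \<noteq> 0" by (intro notI) simp
      then obtain b where "a = Suc b" by (cases a) auto
      with a m show "\<exists>a::nat. m = 2 ^ a" by auto
    next
      assume "\<exists>a::nat. m = 2 ^ a"
      then obtain a where "m = 2 ^ a" by blast
      then have "n = 2 ^ Suc a" using m by simp
      then show "\<exists>a::nat. n = 2 ^ a" by blast
    qed
    have "c mod 4 = 0 \<or> c mod 4 = 2"
      using IH by (simp add: cong_def split: if_splits)
    then have c: "even c" "[- c = c] (mod 4)"
      unfolding cong_def by presburger+
    have c2: "[c = (if \<exists>a::nat. n = 2 ^ a then 2 else 0)] (mod 4)"
      using IH unfolding iff .
    \<comment> \<open>Since \<open>c\<close> is 0 or 2 modulo 4, its square vanishes and its sign is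
      immaterial, so \<open>c ^ 2 - c\<close> is congruent to \<open>c\<close>.\<close>
    have "[c ^ 2 = 0] (mod 4)"
      using c(1) by (auto simp: cong_def power2_eq_square elim!: evenE)
    then have "[c ^ 2 - c = - c] (mod 4)"
      using cong_diff[of "c ^ 2" 0 4 c c] by simp
    moreover have "[int (2 * n choose n) - 2 ^ n = c ^ 2 - c] (mod 4)"
      using main unfolding m c_def by simp
    moreover have "[int (2 * n choose n) = int (2 * n choose n) - 2 ^ n] (mod 4)"
      using pow m \<open>m > 0\<close> by (simp add: cong_iff_dvd_diff)
    ultimately show ?thesis
      using c(2) c2 by (meson cong_trans)
  next
    case False
    then have "[int (2 * n choose n) = 2 ^ n] (mod 4)"
      using main by (simp add: cong_iff_dvd_diff)
    moreover have "[2 ^ n = (if \<exists>a::nat. n = 2 ^ a then 2 else 0 :: int)] (mod 4)"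
    proof (cases "n = 1")
      case True
      then have "\<exists>a::nat. n = 2 ^ a" by (intro exI[of _ 0]) simp
      then show ?thesis using True by simp
    next
      case n1: False
      have "\<not> (\<exists>a::nat. n = 2 ^ a)"
      proof
        assume "\<exists>a::nat. n = 2 ^ a"
        then obtain a where "n = 2 ^ a" by blast
        with n1 False show False by (cases a) auto
      qed
      then show ?thesis
        using pow n1 less.prems by (simp add: cong_0_iff)
    qed
    ultimately show ?thesis by (rule cong_trans)
  qed
qed

text \<open>Pairing is applied to \<open>x ^ 3 - x ^ 2\<close>; its middle term
  \<open>x ^ 2 * (x - 1)\<close> is divisible by 4 because a central binomial is even.\<close>

lemma franel_mod_4:
  assumes "n > 0"
  shows "[int (franel n) = (if \<exists>a::nat. n = 2 ^ a then 2 else 0)] (mod 4)"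
proof -
  have mid: "4 dvd int (n choose (n div 2)) ^ 3 - int (n choose (n div 2)) ^ 2" if "even n"
  proof -
    from that obtain m where m: "n = 2 * m" by (elim evenE)
    then have "[int (2 * m choose m) = (if \<exists>a::nat. m = 2 ^ a then 2 else 0)] (mod 4)"
      using assms by (intro central_binomial_mod_4) simp
    then have "int (2 * m choose m) mod 4 = 0 \<or> int (2 * m choose m) mod 4 = 2"
      by (simp add: cong_def split: if_splits)
    then have "even (int (2 * m choose m))"
      by presburger
    then obtain q where "int (2 * m choose m) = 2 * q" by blast
    then show ?thesis
      by (simp add: m power2_eq_square power3_eq_cube)
  qed
  have "[(\<Sum>k\<le>n. int (n choose k) ^ 3 - int (n choose k) ^ 2)
      = (if even n then int (n choose (n div 2)) ^ 3 - int (n choose (n div 2)) ^ 2 else 0)] (mod 4)"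
    by (rule sum_symmetric_even_mod_4) (auto simp: binomial_symmetric[symmetric])
  then have "[(\<Sum>k\<le>n. int (n choose k) ^ 3 - int (n choose k) ^ 2) = 0] (mod 4)"
    using mid by (auto simp: cong_0_iff cong_dvd_iff split: if_splits)
  then have "[int (franel n) = int (2 * n choose n)] (mod 4)"
    by (simp add: sum_subtractf franel_def atMost_atLeast0 central_binomial_sum
        cong_iff_dvd_diff)
  then show ?thesis
    using central_binomial_mod_4[OF assms] by (rule cong_trans)
qed

section \<open>Cancelling 3 and lifting to the modulus \<open>4 * n ^ 2\<close>\<close>

theorem theorem2p1:
  fixes n :: nat
  assumes "n > 0"
  shows "[(\<Sum>k=0..n-1. (3 * int k + 2) * (-1) ^ k * int (franel k))
          = (if \<exists>a::nat. n = 2 ^ a then 2 * (int n)^2 else 0)] (mod 4 * (int n)^2)"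
proof -
  obtain m where m: "n = Suc m" using assms by (cases n) auto
  define S where "S = (\<Sum>k=0..n-1. (3 * int k + 2) * (-1) ^ k * int (franel k))"
  define c :: int where "c = (if \<exists>a::nat. n = 2 ^ a then 2 else 0)"
  define D where "D = int (franel n) - 8 * int (franel m)"
  have S: "3 * S = (-1) ^ n * int n ^ 2 * D"
    using franel_weighted_alternating_sum[of m] by (simp add: S_def D_def m add.commute)
  have "[D = (-1) ^ n - 8 * (-1) ^ m] (mod 3)"
    unfolding D_def by (intro cong_diff cong_mult franel_mod_3 cong_refl)
  also have "(-1) ^ n - 8 * (-1) ^ m = 3 * (- 3 * (-1) ^ m :: int)"
    by (simp add: m)
  finally have "3 dvd D"
    by (metis cong_dvd_iff dvd_triv_left)
  then obtain q where q: "D = 3 * q" by blast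
  have "[int (franel n) = c] (mod 4)"
    unfolding c_def using assms by (rule franel_mod_4)
  \<comment> \<open>Modulo 4 the term \<open>8 * franel m\<close> drops out and 3 is -1, so
    \<open>q\<close> is congruent to \<open>-c\<close>. As \<open>c\<close> is 0 or 2, both
    \<open>q\<close> and \<open>-q\<close> are congruent to \<open>c\<close>, whatever the sign
    \<open>(-1) ^ n\<close>.\<close>
  then have "[3 * q = c] (mod 4)"
    unfolding cong_def q[symmetric] D_def by presburger
  moreover have "c = 0 \<or> c = 2"
    by (simp add: c_def)
  ultimately have "4 dvd q - c" "4 dvd - q - c"
    unfolding cong_def by presburger+
  then have "4 dvd (-1) ^ n * q - c"
    by (cases "even n") auto
  then have "int n ^ 2 * 4 dvd int n ^ 2 * ((-1) ^ n * q - c)"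
    by (rule mult_dvd_mono[OF dvd_refl])
  moreover have "S = int n ^ 2 * ((-1) ^ n * q)"
    using S unfolding q by simp
  ultimately have "[S = int n ^ 2 * c] (mod 4 * int n ^ 2)"
    by (simp add: cong_iff_dvd_diff right_diff_distrib mult.commute)
  moreover have "int n ^ 2 * c = (if \<exists>a::nat. n = 2 ^ a then 2 * int n ^ 2 else 0)"
    by (simp add: c_def)
  ultimately show ?thesis
    unfolding S_def by simp
qed

end
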